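(* Let $\Gamma$ be a finite nonempty alphabet, and let $n$ and $k$ be positive integers such that $k$ divides $n$ or $n$ divides $k$. Then the factor $F_k(r_n)$ of the astute graph $G_{n,k}$ produced by the pure cycling register rule $r_n$ is extremal; that is, every factor of $G_{n,k}$ contains at most $|F_k(r_n)|$ cycles.
   Context: Astute graph: for positive integers $n,k$, $G_{n,k}$ is the directed graph (loops allowed) with vertex set $V_{n,k}=\Gamma^n\times \mathbb{Z}/k\mathbb{Z}$, with an arc from $(s,i)$ to $(t,j)$ if and only if $j=i+1$ in $\mathbb{Z}/k\mathbb{Z}$ and, writing $s=a_0a_1\cdots a_{n-1}$, $t=t_0\cdots t_{n-1}$, one has $a_1\cdots a_{n-1}=t_0\cdots t_{n-2}$ (the last $n-1$ symbols of $s$ are the first $n-1$ symbols of $t$). ($G_{n,1}$ is the de Bruijn graph of order $n$.) Factor: a factor of $G_{n,k}$ is a set of pairwise vertex-disjoint simple directed cycles (a loop is a cycle of length 1) which together include all vertices of $G_{n,k}$. A factor with the maximum possible number of cycles is called extremal. Pure cycling register: $r_n:\Gamma^n\to\Gamma^n$, $r_n(a_0a_1\cdots a_{n-1})=a_1\cdots a_{n-1}a_0$. $F_k(r_n)$ is the factor of $G_{n,k}$ whose cycles are the orbits of the bijection $A_k(r_n):V_{n,k}\to V_{n,k}$, $(s,i)\mapsto (r_n(s),i+1)$; $|F_k(r_n)|$ is its number of cycles. *)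

theory Defs
  imports "Graph_Theory.Arc_Walk" "HOL-Combinatorics.Orbits"
begin

text \<open>
  A simple directed cycle, as a subgraph, is represented by its set of arcs; this identifies the
  arc lists that differ only in the starting vertex. Loops are cycles of length 1.
  The vertices of a cycle are the tails of its arcs.
\<close>

definition cycles_of :: "('v, 'e) pre_digraph \<Rightarrow> 'e set set" where
  "cycles_of G = {set p | p. pre_digraph.cycle G p}"

definition is_factor :: "('v, 'e) pre_digraph \<Rightarrow> 'e set set \<Rightarrow> bool" where
  "is_factor G F \<longleftrightarrow>
     F \<subseteq> cycles_of G \<and>
     pairwise (\<lambda>c d. disjnt (tail G ` c) (tail G ` d)) F \<and>
     (\<Union>c\<in>F. tail G ` c) = verts G"

text \<open>
  In a graph with finitely many arcs, every factor is a finite set, so the use of \<^const>\<open>card\<close> is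
  unproblematic there.
\<close>

definition extremal_factor :: "('v, 'e) pre_digraph \<Rightarrow> 'e set set \<Rightarrow> bool" where
  "extremal_factor G F \<longleftrightarrow>
     is_factor G F \<and> (\<forall>F'. is_factor G F' \<longrightarrow> card F' \<le> card F)"

definition words :: "'a set \<Rightarrow> nat \<Rightarrow> 'a list set" where
  "words \<Gamma> n = {s. set s \<subseteq> \<Gamma> \<and> length s = n}"

text \<open>The residues modulo \<open>k\<close> are represented by \<open>0, \<dots>, k - 1\<close>.\<close>

definition astute_verts :: "'a set \<Rightarrow> nat \<Rightarrow> nat \<Rightarrow> ('a list \<times> nat) set" where
  "astute_verts \<Gamma> n k = words \<Gamma> n \<times> {0..<k}"

definition astute_graph ::
  "'a set \<Rightarrow> nat \<Rightarrow> nat \<Rightarrow> ('a list \<times> nat, ('a list \<times> nat) \<times> ('a list \<times> nat)) pre_digraph" where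
  "astute_graph \<Gamma> n k =
     \<lparr> verts = astute_verts \<Gamma> n k,
       arcs = {((s, i), (t, j)) | s i t j.
                 (s, i) \<in> astute_verts \<Gamma> n k \<and> (t, j) \<in> astute_verts \<Gamma> n k \<and>
                 j = (i + 1) mod k \<and> tl s = butlast t},
       tail = fst, head = snd \<rparr>"

abbreviation pure_cycling_register :: "'a list \<Rightarrow> 'a list" where
  "pure_cycling_register \<equiv> rotate1"

definition astute_map :: "nat \<Rightarrow> ('a list \<Rightarrow> 'a list) \<Rightarrow> 'a list \<times> nat \<Rightarrow> 'a list \<times> nat" where
  "astute_map k f = (\<lambda>(s, i). (f s, (i + 1) mod k))"

text \<open>
  The constant \<^const>\<open>orbit\<close> collects the iterates with positive exponent, which is the orbit in the
  usual sense when the map permutes a finite set containing the point. The cycle belonging to an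
  orbit consists of the arcs from each of its elements to the image of that element.
\<close>

definition register_factor ::
  "'a set \<Rightarrow> nat \<Rightarrow> nat \<Rightarrow> ('a list \<Rightarrow> 'a list) \<Rightarrow> (('a list \<times> nat) \<times> ('a list \<times> nat)) set set" where
  "register_factor \<Gamma> n k f =
     (\<lambda>v. (\<lambda>w. (w, astute_map k f w)) ` orbit (astute_map k f) v) ` astute_verts \<Gamma> n k"

end

theory Submission
  imports Defs Complex_Main
begin

text \<open>
  The upper bound comes from a transversal: a set \<open>S\<close> of vertices that meets every cycle of the graph
  at least once and every cycle of the given factor at most once. Choosing one point of \<open>S\<close> on each
  cycle embeds any factor into \<open>S\<close>, and \<open>S\<close> embeds into the given factor. What remains is to find \<open>S\<close>.

  If \<open>n\<close> divides \<open>k\<close>, the layer \<open>i = 0\<close> is such a set: every cycle runs through all layers, and every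
  register orbit has length \<open>k\<close>, so that it visits each layer once.

  If \<open>k\<close> divides \<open>n\<close> and \<open>n \<ge> 3\<close>, the argument is Mykkeltveit's for the de Bruijn graph. Assign distinct
  real values to the letters and let \<open>w(s) = \<Sum>\<^sub>j \<omega>\<^sup>j v(s\<^sub>j)\<close> with \<open>\<omega> = exp(2\<pi>i/n)\<close>. Along an arc
  \<open>s \<rightarrow> t\<close> the number \<open>\<omega> w(t) - w(s) = v(t\<^bsub>n-1\<^esub>) - v(s\<^sub>0)\<close> is real (\<open>moment_arc\<close>); for a register
  step it is 0, so that the register turns \<open>w\<close> clockwise by the angle \<open>2\<pi>/n\<close>. The set \<open>S\<close> consists of
  the vertices at which this turn takes \<open>\<omega> w\<close>, in the open upper half plane, to \<open>w\<close>, in the closed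
  lower one, and of one vertex of each register orbit on which \<open>w\<close> vanishes. Since \<open>k\<close> divides \<open>n\<close>, an
  orbit closes up within one full turn, so it contains at most one crossing (\<open>crossing_unique\<close>).

  A cycle without a crossing cannot pass from \<open>Im w > 0\<close> to \<open>Im w \<le> 0\<close>. But the sum of \<open>w\<close> over a cycle
  is 0: each position of the words contributes the same letter sum, multiplied by the corresponding
  root of unity (\<open>weighted_letter_sum_zero\<close>). Hence \<open>Im w\<close> vanishes along the cycle, then so does
  \<open>Im (\<omega> w)\<close>, and then so does \<open>w\<close>. Thus consecutive words differ by a rotation, the cycle is a register
  orbit with \<open>w = 0\<close>, and it contains its chosen representative (\<open>crossing_or_rotating\<close>).

  The only case not covered is \<open>n = 2\<close>, \<open>k = 1\<close>, where \<open>w\<close> is always real; there the words \<open>ab\<close> with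
  \<open>v(a) \<ge> v(b)\<close> serve as \<open>S\<close>, again because the sum of \<open>v(a) - v(b)\<close> over a cycle is 0.
\<close>

section \<open>Vertex-disjoint cycles\<close>

text \<open>
  The graph of a permutation of a finite set, that is, a disjoint union of cycles. Working with such
  unions avoids arguing along a cycle: the part of a cycle on which a condition holds is again of this
  form as soon as the condition is passed on from each vertex to the next.
\<close>

definition perm_arcs :: "('v \<times> 'v) set \<Rightarrow> bool" where
  "perm_arcs D \<longleftrightarrow> finite D \<and> inj_on fst D \<and> inj_on snd D \<and> fst ` D = snd ` D"

lemma cycles_of_perm_arcs:
  assumes "tail G = fst" "head G = snd" "C \<in> cycles_of G"
  shows "C \<subseteq> arcs G" "C \<noteq> {}" "perm_arcs C"
proof -
  from assms(3) obtain p u where C: "C = set p" and p: "pre_digraph.awalk G u p u"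
    and d: "distinct (tl (pre_digraph.awalk_verts G u p))" and ne: "p \<noteq> []"
    unfolding cycles_of_def pre_digraph.cycle_def by blast
  have cas: "pre_digraph.cas G u p u" and sub: "set p \<subseteq> arcs G"
    using p unfolding pre_digraph.awalk_def by auto
  have heads: "pre_digraph.awalk_verts G u p = fst (hd p) # map snd p"
    using pre_digraph.awalk_verts_conv'[OF cas] ne assms by simp
  have tails: "pre_digraph.awalk_verts G u p = map fst p @ [snd (last p)]"
    using pre_digraph.awalk_verts_conv[of G u p] ne assms by simp
  \<comment> \<open>The vertex list is \<open>u\<close> followed by the heads, and also the tails followed by \<open>u\<close>. Cancelling \<open>u\<close>
     shows that heads and tails agree as multisets.\<close>
  have "pre_digraph.cas G u' q u'' \<Longrightarrow> q \<noteq> [] \<Longrightarrow> snd (last q) = u''" for u' u'' q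
    using assms(2) by (induction q arbitrary: u') (auto simp: pre_digraph.cas.simps)
  hence last: "snd (last p) = u" using cas ne by blast
  have first: "fst (hd p) = u"
    using pre_digraph.cas_simp[of p G u u] ne cas assms(1) by simp
  have "mset (map fst p @ [u]) = mset (u # map snd p)"
    using heads tails last first by simp
  hence ms: "mset (map fst p) = mset (map snd p)" by simp
  have dh: "distinct (map snd p)" using d heads by simp
  have dt: "distinct (map fst p)" using ms dh mset_eq_imp_distinct_iff by blast
  have "fst ` set p = snd ` set p" using mset_eq_setD[OF ms] by simp
  thus "C \<subseteq> arcs G" "C \<noteq> {}" "perm_arcs C"
    using sub ne dh dt C by (auto simp: perm_arcs_def distinct_map)
qed

text \<open>
  The cycles of a factor are disjoint, so choosing a point of \<open>S\<close> on each of them is injective. They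
  cover all vertices, so conversely the points of \<open>S\<close> lie on distinct cycles of \<open>F\<close>.
\<close>

lemma extremal_factor_by_transversal:
  assumes fin: "finite (verts G)"
    and F: "is_factor G F"
    and S: "S \<subseteq> verts G"
    and hits: "\<And>c. c \<in> cycles_of G \<Longrightarrow> tail G ` c \<inter> S \<noteq> {}"
    and once: "\<And>c x y. c \<in> F \<Longrightarrow> x \<in> tail G ` c \<inter> S \<Longrightarrow> y \<in> tail G ` c \<inter> S \<Longrightarrow> x = y"
  shows "extremal_factor G F"
proof -
  have finS: "finite S" using fin S finite_subset by blast
  have choice: "\<exists>f. inj_on f F' \<and> f ` F' \<subseteq> S" if F': "is_factor G F'" for F'
  proof -
    define f where "f c = (SOME x. x \<in> tail G ` c \<inter> S)" for c
    have f: "f c \<in> tail G ` c \<inter> S" if "c \<in> F'" for c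
    proof -
      have "c \<in> cycles_of G" using that F' by (auto simp: is_factor_def)
      thus ?thesis using hits[of c] unfolding f_def by (metis some_in_eq)
    qed
    have "inj_on f F'"
    proof (rule inj_onI, rule ccontr)
      fix c d assume cd: "c \<in> F'" "d \<in> F'" "f c = f d" "c \<noteq> d"
      hence "disjnt (tail G ` c) (tail G ` d)"
        using F' unfolding is_factor_def by (blast dest: pairwiseD)
      thus False using f[OF cd(1)] f[OF cd(2)] cd(3) by (auto simp: disjnt_iff)
    qed
    thus ?thesis using f by blast
  qed
  have le: "card F' \<le> card S" if F': "is_factor G F'" for F'
  proof -
    obtain f where "inj_on f F'" "f ` F' \<subseteq> S" using choice[OF F'] by blast
    thus ?thesis using finS by (intro card_inj_on_le[of f]) auto
  qed
  have ge: "card S \<le> card F"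
  proof -
    have "\<forall>x\<in>S. \<exists>c. c \<in> F \<and> x \<in> tail G ` c"
    proof
      fix x assume "x \<in> S"
      moreover have "(\<Union>c\<in>F. tail G ` c) = verts G" using F by (simp add: is_factor_def)
      ultimately have "x \<in> (\<Union>c\<in>F. tail G ` c)" using S by (metis subsetD)
      thus "\<exists>c. c \<in> F \<and> x \<in> tail G ` c" by (metis UN_E)
    qed
    from bchoice[OF this] obtain g where g: "\<forall>x\<in>S. g x \<in> F \<and> x \<in> tail G ` g x" ..
    have inj: "inj_on g S"
    proof (rule inj_onI)
      fix x y assume xy: "x \<in> S" "y \<in> S" "g x = g y"
      show "x = y" by (rule once[of "g x"]) (use g xy in auto)
    qed
    \<comment> \<open>Finiteness of \<open>F\<close>, without which its cardinality would be the default value 0.\<close>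
    obtain f where "inj_on f F" "f ` F \<subseteq> S" using choice[OF F] by blast
    hence "finite F" using finS by (meson inj_on_finite)
    thus ?thesis using g inj by (intro card_inj_on_le[of g]) blast+
  qed
  show ?thesis unfolding extremal_factor_def using F order.trans[OF le ge] by simp
qed

section \<open>Arcs and register orbits in the astute graph\<close>

lemma astute_arc_iff:
  "((s, i), (t, j)) \<in> arcs (astute_graph \<Gamma> n k) \<longleftrightarrow>
     s \<in> words \<Gamma> n \<and> i < k \<and> t \<in> words \<Gamma> n \<and> j < k \<and> j = (i + 1) mod k \<and> tl s = butlast t"
  by (auto simp: astute_graph_def astute_verts_def)

lemma astute_arc_nth:
  assumes "(x, y) \<in> arcs (astute_graph \<Gamma> n k)" "Suc j < n"
  shows "fst x ! Suc j = fst y ! j"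
proof -
  obtain s i t i' where xy: "x = (s, i)" "y = (t, i')" by fastforce
  have len: "length s = n" "length t = n" and eq: "tl s = butlast t"
    using assms unfolding xy astute_arc_iff words_def by auto
  have "s ! Suc j = tl s ! j" using len assms(2) by (simp add: nth_tl)
  also have "\<dots> = t ! j" unfolding eq using len assms(2) by (simp add: nth_butlast)
  finally show ?thesis by (simp add: xy)
qed

lemma astute_map_funpow:
  "i < k \<Longrightarrow> (astute_map k f ^^ m) (s, i) = ((f ^^ m) s, (i + m) mod k)"
  by (induction m) (auto simp: astute_map_def mod_simps)

lemma astute_map_in_verts:
  "x \<in> astute_verts \<Gamma> n k \<Longrightarrow> astute_map k rotate1 x \<in> astute_verts \<Gamma> n k"
  by (auto simp: astute_verts_def astute_map_def words_def)

lemma astute_map_arc: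
  assumes "x \<in> astute_verts \<Gamma> n k" "n > 0"
  shows "(x, astute_map k rotate1 x) \<in> arcs (astute_graph \<Gamma> n k)"
proof -
  obtain s i where x: "x = (s, i)" by fastforce
  have "tl s = butlast (rotate1 s)"
    using assms by (cases s) (auto simp: x astute_verts_def words_def)
  thus ?thesis using assms astute_map_in_verts[OF assms(1)]
    by (auto simp: x astute_arc_iff astute_map_def astute_verts_def)
qed

lemma rotate1_funpow_length: "n dvd m \<Longrightarrow> length s = n \<Longrightarrow> (rotate1 ^^ m) s = s"
  using rotate_id[of m s] by (simp add: rotate_def mod_eq_0_iff_dvd)

lemma astute_map_period:
  assumes "x \<in> astute_verts \<Gamma> n k" "n dvd m" "k dvd m"
  shows "(astute_map k rotate1 ^^ m) x = x"
proof -
  obtain s i where x: "x = (s, i)" by fastforce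
  have i: "i < k" "length s = n" using assms(1) by (auto simp: x astute_verts_def words_def)
  have "(i + m) mod k = i" using i assms(3) by (auto elim!: dvdE)
  thus ?thesis using i rotate1_funpow_length[OF assms(2)] by (simp add: x astute_map_funpow)
qed

lemma astute_orbit_self:
  assumes "x \<in> astute_verts \<Gamma> n k" "n > 0" "k > 0"
  shows "x \<in> orbit (astute_map k rotate1) x"
  using astute_map_period[OF assms(1), of "n * k"] assms(2,3)
  by (auto simp: orbit_altdef intro!: exI[of _ "n * k"])

lemma astute_orbit_in_verts:
  assumes "x \<in> astute_verts \<Gamma> n k" "y \<in> orbit (astute_map k rotate1) x"
  shows "y \<in> astute_verts \<Gamma> n k"
  using assms(2) by induction (auto intro: astute_map_in_verts assms(1))

lemma orbit_eq_if_self: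
  assumes "x \<in> orbit f x" "y \<in> orbit f x"
  shows "orbit f y = orbit f x"
  using assms by (meson orbit_swap orbit_trans subsetI subset_antisym)

text \<open>
  The cycle starts at \<open>x\<close> and follows \<open>f\<close> up to the first return to \<open>x\<close>; minimality of the return time
  makes its vertices distinct.
\<close>

lemma orbit_cycle:
  fixes G :: "('v, 'v \<times> 'v) pre_digraph"
  assumes ends: "tail G = fst" "head G = snd"
    and self: "x \<in> orbit f x" and xG: "x \<in> verts G"
    and arcs: "\<And>y. y \<in> orbit f x \<Longrightarrow> (y, f y) \<in> arcs G"
  shows "(\<lambda>y. (y, f y)) ` orbit f x \<in> cycles_of G"
proof -
  define L where "L = funpow_dist1 f x x"
  define walk where "walk m = map (\<lambda>i. ((f ^^ i) x, (f ^^ Suc i) x)) [0..<m]" for m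
  have orb: "orbit f x = (\<lambda>i. (f ^^ i) x) ` {0..<L}"
    unfolding L_def by (rule orbit_conv_funpow_dist1[OF self])
  have per: "(f ^^ L) x = x" unfolding L_def by (rule funpow_dist1_prop[OF self])
  have L: "L > 0" by (simp add: L_def)
  have set: "set (walk L) = (\<lambda>y. (y, f y)) ` orbit f x"
    by (auto simp: walk_def orb image_image)
  have aw: "pre_digraph.awalk_verts G u (walk (Suc m))
      = map (\<lambda>i. (f ^^ i) x) [0..<Suc m] @ [(f ^^ Suc m) x]" for m u
    unfolding pre_digraph.awalk_verts_conv by (simp add: walk_def ends)
  have cas: "pre_digraph.cas G x (walk m) ((f ^^ m) x)" for m
  proof (induction m)
    case 0 show ?case by (simp add: walk_def pre_digraph.cas.simps)
  next
    case (Suc m)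
    have last: "last (pre_digraph.awalk_verts G x (walk m)) = (f ^^ m) x"
      by (cases m) (simp_all add: aw walk_def pre_digraph.awalk_verts.simps
          pre_digraph.awalk_verts_conv ends)
    have "walk (Suc m) = walk m @ [((f ^^ m) x, (f ^^ Suc m) x)]" by (simp add: walk_def)
    thus ?case using Suc last
      by (simp add: pre_digraph.cas_append_iff pre_digraph.cas.simps ends)
  qed
  have walk: "pre_digraph.awalk G x (walk L) x"
    using cas[of L] per set arcs xG by (auto simp: pre_digraph.awalk_def)
  have tl: "tl (pre_digraph.awalk_verts G x (walk L)) = map snd (walk L)"
    using pre_digraph.awalk_verts_conv'[OF cas[of L]] L by (auto simp: ends walk_def)
  have "inj_on (\<lambda>i. (f ^^ i) x) {0..<L}"
    unfolding L_def by (rule inj_on_funpow_dist1[OF self])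
  hence "distinct (map (\<lambda>i. (f ^^ i) x) [0..<L])" by (simp add: distinct_map)
  moreover have "mset (map snd (walk L)) = mset (map (\<lambda>i. (f ^^ i) x) [0..<L])"
  proof -
    have "[0..<Suc L] = 0 # map Suc [0..<L]" by (simp add: map_Suc_upt upt_conv_Cons del: upt_Suc)
    hence "map (\<lambda>i. (f ^^ i) x) [0..<Suc L] = x # map snd (walk L)"
      by (simp add: walk_def o_def del: upt_Suc)
    moreover have "map (\<lambda>i. (f ^^ i) x) [0..<Suc L] = map (\<lambda>i. (f ^^ i) x) [0..<L] @ [x]"
      using per by simp
    ultimately have "mset (x # map snd (walk L)) = mset (map (\<lambda>i. (f ^^ i) x) [0..<L] @ [x])"
      by presburger
    thus ?thesis by simp
  qed
  ultimately have "distinct (map snd (walk L))" using mset_eq_imp_distinct_iff by blast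
  hence "pre_digraph.cycle G (walk L)"
    unfolding pre_digraph.cycle_def using walk tl L by (auto simp: walk_def)
  thus ?thesis unfolding cycles_of_def using set by blast
qed

lemma register_factor_is_factor:
  assumes "n > 0" "k > 0"
  shows "is_factor (astute_graph \<Gamma> n k) (register_factor \<Gamma> n k rotate1)"
proof -
  let ?A = "astute_map k rotate1" and ?G = "astute_graph \<Gamma> n k" and ?V = "astute_verts \<Gamma> n k"
  have G: "tail ?G = fst" "head ?G = snd" "verts ?G = ?V" by (auto simp: astute_graph_def)
  have self: "x \<in> orbit ?A x" if "x \<in> ?V" for x using astute_orbit_self that assms by blast
  have cyc: "(\<lambda>y. (y, ?A y)) ` orbit ?A x \<in> cycles_of ?G" if "x \<in> ?V" for x
  proof (rule orbit_cycle)
    show "(y, ?A y) \<in> arcs ?G" if "y \<in> orbit ?A x" for y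
      using astute_map_arc[OF astute_orbit_in_verts[OF \<open>x \<in> ?V\<close> that] assms(1)] .
  qed (use that self G in auto)
  have tails: "fst ` (\<lambda>y. (y, ?A y)) ` X = X" for X by (force simp: image_image)
  have dj: "orbit ?A x = orbit ?A y" if "x \<in> ?V" "y \<in> ?V" "z \<in> orbit ?A x" "z \<in> orbit ?A y" for x y z
    using that self orbit_eq_if_self by metis
  have pw: "pairwise (\<lambda>c d. disjnt (fst ` c) (fst ` d)) (register_factor \<Gamma> n k rotate1)"
    unfolding register_factor_def pairwise_def disjnt_iff using tails dj by (smt (verit) imageE)
  have "(\<Union>c\<in>register_factor \<Gamma> n k rotate1. fst ` c) = ?V"
    using self astute_orbit_in_verts unfolding register_factor_def by (auto simp: tails)
  thus ?thesis unfolding is_factor_def G using pw cyc by (auto simp: register_factor_def)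
qed

text \<open>
  The form in which the three cases use the transversal argument. The hitting condition is demanded of
  all nonempty unions of cycles, which is no stronger than demanding it of single cycles.
\<close>

lemma extremal_register_factor_by_transversal:
  assumes "finite \<Gamma>" "n > 0" "k > 0"
    and S: "S \<subseteq> astute_verts \<Gamma> n k"
    and hits: "\<And>C. C \<subseteq> arcs (astute_graph \<Gamma> n k) \<Longrightarrow> C \<noteq> {} \<Longrightarrow> perm_arcs C \<Longrightarrow> fst ` C \<inter> S \<noteq> {}"
    and once: "\<And>x y. x \<in> S \<Longrightarrow> y \<in> S \<Longrightarrow> y \<in> orbit (astute_map k rotate1) x \<Longrightarrow> x = y"
  shows "extremal_factor (astute_graph \<Gamma> n k) (register_factor \<Gamma> n k rotate1)"
proof (rule extremal_factor_by_transversal[where S = S])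
  let ?A = "astute_map k rotate1" and ?G = "astute_graph \<Gamma> n k" and ?V = "astute_verts \<Gamma> n k"
  have G: "tail ?G = fst" "head ?G = snd" "verts ?G = ?V" by (auto simp: astute_graph_def)
  have "words \<Gamma> n = {xs. set xs \<subseteq> \<Gamma> \<and> length xs = n}" by (simp add: words_def)
  hence "finite (words \<Gamma> n)" using finite_lists_length_eq[OF assms(1)] by simp
  thus "finite (verts ?G)" unfolding G astute_verts_def by simp
  show "is_factor ?G (register_factor \<Gamma> n k rotate1)"
    by (rule register_factor_is_factor[OF assms(2,3)])
  show "S \<subseteq> verts ?G" using S G by simp
  show "tail ?G ` c \<inter> S \<noteq> {}" if "c \<in> cycles_of ?G" for c
    using cycles_of_perm_arcs[OF G(1,2) that] hits G by simp
  show "x = y" if c: "c \<in> register_factor \<Gamma> n k rotate1"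
    and x: "x \<in> tail ?G ` c \<inter> S" and y: "y \<in> tail ?G ` c \<inter> S" for c x y
  proof -
    obtain v where v: "v \<in> ?V" "c = (\<lambda>w. (w, ?A w)) ` orbit ?A v"
      using c unfolding register_factor_def by blast
    have "x \<in> orbit ?A v" "y \<in> orbit ?A v" using x y v by (auto simp: G)
    moreover have "v \<in> orbit ?A v" using astute_orbit_self[OF v(1) assms(2,3)] .
    ultimately have "y \<in> orbit ?A x" using orbit_eq_if_self by metis
    thus ?thesis using once x y by blast
  qed
qed

section \<open>Zero sums along cycles\<close>

text \<open>
  Along an arc, letter \<open>j + 1\<close> of the tail is letter \<open>j\<close> of the head. Summed over arcs whose tails are
  also their heads, the letters at each position therefore have the same total \<open>T 0\<close>, which factors
  out of the weighted sum.
\<close>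

lemma weighted_letter_sum_zero:
  fixes c :: "nat \<Rightarrow> 'b::comm_ring" and v :: "'a \<Rightarrow> 'b"
  assumes D: "D \<subseteq> arcs (astute_graph \<Gamma> n k)" "perm_arcs D"
    and c: "(\<Sum>j<n. c j) = 0"
  shows "(\<Sum>x\<in>fst ` D. \<Sum>j<n. c j * v (fst x ! j)) = 0"
proof -
  define T where "T j = (\<Sum>x\<in>fst ` D. v (fst x ! j))" for j
  have inj: "inj_on fst D" "inj_on snd D" and eq: "fst ` D = snd ` D"
    using D(2) by (auto simp: perm_arcs_def)
  have step: "T (Suc j) = T j" if "Suc j < n" for j
  proof -
    have "T (Suc j) = (\<Sum>e\<in>D. v (fst (fst e) ! Suc j))"
      unfolding T_def by (subst sum.reindex[OF inj(1)]) simp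
    also have "\<dots> = (\<Sum>e\<in>D. v (fst (snd e) ! j))"
    proof (rule sum.cong)
      fix e assume "e \<in> D"
      hence "(fst e, snd e) \<in> arcs (astute_graph \<Gamma> n k)" using D(1) by auto
      from astute_arc_nth[OF this that]
      show "v (fst (fst e) ! Suc j) = v (fst (snd e) ! j)" by simp
    qed simp
    also have "\<dots> = T j" unfolding T_def eq by (subst sum.reindex[OF inj(2)]) simp
    finally show ?thesis .
  qed
  have T: "T j = T 0" if "j < n" for j using that by (induction j) (auto simp: step)
  have "(\<Sum>x\<in>fst ` D. \<Sum>j<n. c j * v (fst x ! j)) = (\<Sum>j<n. c j * T j)"
    unfolding T_def by (subst sum.swap) (simp add: sum_distrib_left)
  also have "\<dots> = (\<Sum>j<n. c j * T 0)" by (intro sum.cong refl arg_cong2[where f = "(*)"] T) simp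
  also have "\<dots> = 0" using c by (simp flip: sum_distrib_right)
  finally show ?thesis .
qed

text \<open>The first Fourier coefficient of the sequence of letter values.\<close>

definition moment :: "('a \<Rightarrow> real) \<Rightarrow> 'a list \<Rightarrow> complex" where
  "moment v s = (\<Sum>j<length s. cis (2 * pi * j / length s) * of_real (v (s ! j)))"

lemma sum_cis_roots:
  assumes "n \<ge> 2"
  shows "(\<Sum>j<n. cis (2 * pi * real j / n)) = 0"
proof -
  let ?w = "cis (2 * pi / n)"
  have "?w \<noteq> 1"
  proof
    assume "?w = 1"
    hence "cos (2 * pi / n) = 1" by (metis cis.sel(1) one_complex.sel(1))
    moreover have "cos (2 * pi / n) < cos 0"
      using assms by (intro cos_monotone_0_pi) (auto simp: field_simps)
    ultimately show False by simp
  qed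
  moreover have "?w ^ n = 1" using assms by (simp add: DeMoivre)
  ultimately have "(\<Sum>j<n. ?w ^ j) = 0" by (simp add: geometric_sum)
  moreover have "?w ^ j = cis (2 * pi * real j / n)" for j by (simp add: DeMoivre mult.commute)
  ultimately show ?thesis by simp
qed

text \<open>
  Multiplication by \<open>cis (2 * pi / n)\<close> undoes the shift of positions. The two words then differ only in
  the letter that leaves and the letter that enters; both get weight 1, because position \<open>n\<close> has the
  weight of position 0. In particular, the imaginary part does not see the difference.
\<close>

lemma moment_arc:
  assumes "(x, y) \<in> arcs (astute_graph \<Gamma> n k)" "n > 0"
  shows "cis (2 * pi / n) * moment v (fst y)
    = moment v (fst x) + of_real (v (last (fst y)) - v (hd (fst x)))"
proof -
  obtain m where n: "n = Suc m" using assms(2) by (cases n) auto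
  obtain s i t i' where xy: "x = (s, i)" "y = (t, i')" by fastforce
  have len: "length s = n" "length t = n"
    using assms(1) by (auto simp: xy astute_arc_iff words_def)
  have nth: "s ! Suc j = t ! j" if "j < m" for j
    using astute_arc_nth[OF assms(1), of j] that by (simp add: n xy)
  have hd: "hd s = s ! 0" and last: "last t = t ! m"
    using len by (auto simp: n hd_conv_nth last_conv_nth simp flip: length_greater_0_conv)
  define z where "z j = cis (2 * pi * real j / n)" for j
  have z: "cis (2 * pi / n) * z j = z (Suc j)" for j
    by (simp add: z_def cis_mult add_divide_distrib distrib_left)
  have zn: "z n = 1" "z 0 = 1" using assms(2) by (simp_all add: z_def)
  have "cis (2 * pi / n) * moment v t = (\<Sum>j<Suc m. z (Suc j) * of_real (v (t ! j)))"
    unfolding moment_def len z_def[symmetric] sum_distrib_left mult.assoc[symmetric] z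
    by (simp only: n)
  also have "\<dots> = (\<Sum>j<m. z (Suc j) * of_real (v (t ! j))) + of_real (v (t ! m))"
    using zn n by simp
  also have "(\<Sum>j<m. z (Suc j) * of_real (v (t ! j))) = (\<Sum>j<m. z (Suc j) * of_real (v (s ! Suc j)))"
    by (intro sum.cong) (auto simp: nth)
  also have "\<dots> = (\<Sum>j<Suc m. z j * of_real (v (s ! j))) - of_real (v (s ! 0))"
    unfolding sum.lessThan_Suc_shift using zn by simp
  also have "(\<Sum>j<Suc m. z j * of_real (v (s ! j))) = moment v s"
    by (simp only: moment_def len z_def n)
  finally show ?thesis by (simp add: xy hd last)
qed

lemma moment_astute_map:
  assumes "x \<in> astute_verts \<Gamma> n k" "n > 0"
  shows "cis (2 * pi / n) * moment v (fst (astute_map k rotate1 x)) = moment v (fst x)"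
proof -
  obtain s i where x: "x = (s, i)" by fastforce
  have "last (rotate1 s) = hd s"
    using assms by (cases s) (auto simp: x astute_verts_def words_def)
  thus ?thesis using moment_arc[OF astute_map_arc[OF assms] assms(2), of v]
    by (simp add: x astute_map_def)
qed

lemma moment_astute_map_funpow:
  assumes "x \<in> astute_verts \<Gamma> n k" "n > 0"
  shows "cis (2 * pi / n) ^ m * moment v (fst ((astute_map k rotate1 ^^ m) x)) = moment v (fst x)"
proof (induction m)
  case (Suc m)
  have "(astute_map k rotate1 ^^ m) x \<in> astute_verts \<Gamma> n k"
    by (induction m) (auto intro: astute_map_in_verts assms(1))
  from moment_astute_map[OF this assms(2), of v] Suc show ?case
    by (simp add: mult.assoc) (metis mult.left_commute)
qed simp

lemma moment_orbit_zero_iff: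
  assumes "x \<in> astute_verts \<Gamma> n k" "n > 0" "y \<in> orbit (astute_map k rotate1) x"
  shows "moment v (fst y) = 0 \<longleftrightarrow> moment v (fst x) = 0"
proof -
  obtain m where "y = (astute_map k rotate1 ^^ m) x" using assms(3) by (auto simp: orbit_altdef)
  thus ?thesis using moment_astute_map_funpow[OF assms(1,2), of m v] by (metis cis_neq_zero
        mult_eq_0_iff power_not_zero)
qed

section \<open>Crossing the real axis\<close>

text \<open>
  For \<open>n \<ge> 3\<close> this is the cone of the nonzero numbers that have an argument in the half-open interval
  from \<open>-2 * pi / n\<close> (excluded) to 0 (included): the points that a clockwise turn by \<open>2 * pi / n\<close> has
  just taken from the open upper half plane to the closed lower one.
\<close>

definition crossing :: "nat \<Rightarrow> complex \<Rightarrow> bool" where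
  "crossing n z \<longleftrightarrow> Im z \<le> 0 \<and> Im (cis (2 * pi / n) * z) > 0"

text \<open>
  The clockwise turns of a half-open cone of angle \<open>2 * pi / n\<close> by \<open>0, \<dots>, n - 1\<close> times that angle are
  pairwise disjoint.
\<close>

lemma crossing_unique:
  assumes n: "n \<ge> 3" and m: "m < n"
    and z: "crossing n z" and z': "crossing n z'" and eq: "cis (2 * pi / n) ^ m * z' = z"
  shows "m = 0"
proof (rule ccontr)
  assume "m \<noteq> 0"
  define \<theta> where "\<theta> = 2 * pi / n"
  have th: "0 < \<theta>" "\<theta> < pi" "n * \<theta> = 2 * pi" using n by (auto simp: \<theta>_def field_simps)
  define r a where "r = cmod z" and "a = Arg z"
  have za: "z = rcis r a" by (simp add: r_def a_def rcis_cmod_Arg)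
  have "z \<noteq> 0" using z by (auto simp: crossing_def)
  hence r: "r > 0" by (simp add: r_def)
  have im: "sin a \<le> 0" "sin (a + \<theta>) > 0"
    using z r unfolding crossing_def za \<theta>_def[symmetric]
    by (auto simp: cis_rcis_eq rcis_mult mult_le_0_iff zero_less_mult_iff add.commute)
  have ab: "-pi < a" "a \<le> pi" using Arg_bounded[of z] by (auto simp: a_def)
  have "a \<noteq> pi" using im th by (auto simp: sin_add) (smt (verit) sin_gt_zero)
  hence a0: "a \<le> 0" using im(1) ab sin_gt_zero[of a] by force
  \<comment> \<open>Together with \<open>a0\<close>, this places \<open>z\<close> in the cone. Turning by \<open>m * \<theta>\<close> with \<open>0 < m < n\<close> leads either to
     the open upper half plane or to a point that turning back by \<open>\<theta>\<close> does not bring there.\<close>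
  have a1: "a > -\<theta>"
  proof (rule ccontr)
    assume "\<not> a > -\<theta>"
    hence "sin (a + \<theta>) \<le> 0" using ab th sin_ge_zero[of "-(a + \<theta>)"] by (auto simp del: minus_add_distrib)
    thus False using im by simp
  qed
  have "z' = cis (- (m * \<theta>)) * z"
    unfolding eq[symmetric] by (simp add: DeMoivre \<theta>_def[symmetric] cis_mult flip: mult.assoc)
  hence z'a: "z' = rcis r (a - m * \<theta>)" by (simp add: za cis_rcis_eq rcis_mult)
  have im': "sin (a - m * \<theta>) \<le> 0" "sin (a - m * \<theta> + \<theta>) > 0"
    using z' r unfolding crossing_def z'a \<theta>_def[symmetric]
    by (auto simp: cis_rcis_eq rcis_mult mult_le_0_iff zero_less_mult_iff add.commute)
  have m1: "m * \<theta> \<ge> \<theta>" using \<open>m \<noteq> 0\<close> th by (cases m) (auto simp: algebra_simps)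
  have "real (Suc m) * \<theta> \<le> n * \<theta>" using m th by (intro mult_right_mono) auto
  hence m2: "m * \<theta> \<le> 2 * pi - \<theta>" using th by (simp add: algebra_simps)
  show False
  proof (cases "a - m * \<theta> < -pi")
    case True
    have "sin (a - m * \<theta> + 2 * pi) > 0" using True m2 a1 by (intro sin_gt_zero) auto
    thus False using im' by (simp add: sin_periodic)
  next
    case False
    have "sin (-(a - m * \<theta> + \<theta>)) \<ge> 0" using False m1 a0 th by (intro sin_ge_zero) linarith+
    thus False using im' unfolding sin_minus by linarith
  qed
qed

text \<open>
  A union of cycles without crossings consists of register steps between words of moment 0. Without a
  crossing, a positive imaginary part is passed on to the next vertex. The vertices with positive
  imaginary part thus form a union of cycles by themselves, over which the sum of the moments is 0,
  so there are none. As the sum over all vertices is 0 too, every imaginary part is 0.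
\<close>

lemma crossing_or_rotating:
  fixes v :: "'a \<Rightarrow> real"
  assumes n: "n \<ge> 3" and v: "inj_on v \<Gamma>"
    and C: "C \<subseteq> arcs (astute_graph \<Gamma> n k)" "perm_arcs C"
    and no: "\<And>x. x \<in> fst ` C \<Longrightarrow> \<not> crossing n (moment v (fst x))"
  shows "\<And>x. x \<in> fst ` C \<Longrightarrow> moment v (fst x) = 0"
    and "\<And>x y. (x, y) \<in> C \<Longrightarrow> y = astute_map k rotate1 x"
proof -
  let ?G = "astute_graph \<Gamma> n k"
  define w where "w x = moment v (fst x)" for x :: "'a list \<times> nat"
  define h where "h x = Im (w x)" for x
  have finC: "finite C" and inj: "inj_on fst C" "inj_on snd C" and eq: "fst ` C = snd ` C"
    using C(2) by (auto simp: perm_arcs_def)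
  have arc_im: "Im (cis (2 * pi / n) * w y) = h x" if "(x, y) \<in> C" for x y
  proof -
    have "(x, y) \<in> arcs ?G" "n > 0" using that C(1) n by auto
    from moment_arc[OF this, of v] show ?thesis by (simp add: w_def h_def del: times_complex.sel)
  qed
  have len: "length (fst x) = n" if "x \<in> fst ` C" for x
    using that C(1) by (fastforce simp: astute_graph_def astute_verts_def words_def)
  have sum0: "(\<Sum>x\<in>fst ` D. h x) = 0" if D: "D \<subseteq> C" "perm_arcs D" for D
  proof -
    have "(\<Sum>x\<in>fst ` D. w x)
      = (\<Sum>x\<in>fst ` D. \<Sum>j<n. cis (2 * pi * real j / n) * of_real (v (fst x ! j)))"
      using D len by (intro sum.cong) (auto simp: w_def moment_def)
    also have "\<dots> = 0"
      using D C(1) n sum_cis_roots[of n]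
      by (intro weighted_letter_sum_zero[where v = "\<lambda>a. complex_of_real (v a)"]) auto
    finally show ?thesis unfolding h_def by (simp flip: Im_sum)
  qed
  define D where "D = {e \<in> C. h (fst e) > 0}"
  \<comment> \<open>The heads of \<open>D\<close> lie among its tails, and there are equally many of both.\<close>
  have le: "snd ` D \<subseteq> fst ` D"
  proof
    fix y assume "y \<in> snd ` D"
    then obtain x where xy: "(x, y) \<in> C" "h x > 0" by (auto simp: D_def)
    have y: "y \<in> fst ` C" using xy eq by force
    have "h y > 0"
      using no[OF y] arc_im[OF xy(1)] xy(2) by (auto simp: crossing_def h_def w_def)
    thus "y \<in> fst ` D" using y by (force simp: D_def)
  qed
  have DC: "D \<subseteq> C" by (auto simp: D_def)
  have finD: "finite D" using finC DC finite_subset by blast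
  have injD: "inj_on fst D" "inj_on snd D" using inj DC inj_on_subset by blast+
  have "fst ` D = snd ` D"
    using card_subset_eq[OF _ le] finD injD by (simp add: card_image)
  hence "perm_arcs D" using finD injD by (simp add: perm_arcs_def)
  from sum0[OF DC this] have s: "(\<Sum>x\<in>fst ` D. h x) = 0" .
  have "D = {}"
  proof (rule ccontr)
    assume "D \<noteq> {}"
    hence "(\<Sum>x\<in>fst ` D. h x) > 0" using finD by (intro sum_pos) (auto simp: D_def)
    thus False using s by simp
  qed
  hence nonpos: "h x \<le> 0" if "x \<in> fst ` C" for x using that by (force simp: D_def not_less)
  have h0: "h x = 0" if "x \<in> fst ` C" for x
    using sum_nonneg_eq_0_iff[of "fst ` C" "\<lambda>x. - h x"] finC nonpos sum0[OF subset_refl C(2)] that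
    by (auto simp: sum_negf)
  \<comment> \<open>Both \<open>w y\<close> and its product with \<open>cis (2 * pi / n)\<close> are real. As \<open>n \<ge> 3\<close>, the factor is not real.\<close>
  have w0: "w y = 0" if y: "y \<in> fst ` C" for y
  proof -
    obtain x where xy: "(x, y) \<in> C" using y eq by force
    have "h x = 0" using xy by (intro h0) force
    hence "Im (cis (2 * pi / n) * w y) = 0" using arc_im[OF xy] by simp
    moreover have "Im (w y) = 0" using h0[OF y] by (simp add: h_def)
    moreover have "sin (2 * pi / n) > 0" using n by (intro sin_gt_zero) (auto simp: field_simps)
    ultimately show ?thesis by (simp add: complex_eq_iff)
  qed
  thus "\<And>x. x \<in> fst ` C \<Longrightarrow> moment v (fst x) = 0" by (simp add: w_def)
  show "y = astute_map k rotate1 x" if xy: "(x, y) \<in> C" for x y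
  proof -
    have arc: "(x, y) \<in> arcs ?G" using xy C(1) by blast
    obtain s i t j where st: "x = (s, i)" "y = (t, j)" by fastforce
    have st_arc: "s \<in> words \<Gamma> n" "t \<in> words \<Gamma> n" "j = (i + 1) mod k" "tl s = butlast t"
      using arc unfolding st astute_arc_iff by auto
    have ne: "s \<noteq> []" "t \<noteq> []" using st_arc n by (auto simp: words_def)
    have "w x = 0" "w y = 0" using xy eq by (auto intro!: w0 simp: image_iff) force+
    hence "v (last t) = v (hd s)"
      using moment_arc[OF arc, of v] n by (simp add: w_def st del: of_real_diff)
    moreover have "last t \<in> \<Gamma>" "hd s \<in> \<Gamma>" using st_arc ne by (auto simp: words_def)
    ultimately have "last t = hd s" using v by (auto dest: inj_onD)
    hence "t = tl s @ [hd s]" using st_arc(4) ne by (metis append_butlast_last_id)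
    hence "t = rotate1 s" using ne by (cases s) auto
    thus ?thesis using st_arc by (simp add: st astute_map_def)
  qed
qed

lemma perm_arcs_orbit_subset:
  assumes "perm_arcs C" "\<And>x y. (x, y) \<in> C \<Longrightarrow> y = f x" "x \<in> fst ` C"
  shows "orbit f x \<subseteq> fst ` C"
proof
  have step: "f y \<in> fst ` C" if "y \<in> fst ` C" for y
  proof -
    obtain z where "(y, z) \<in> C" using \<open>y \<in> fst ` C\<close> by force
    hence "f y \<in> snd ` C" using assms(2) by force
    thus ?thesis using assms(1) by (simp add: perm_arcs_def)
  qed
  fix y assume "y \<in> orbit f x"
  thus "y \<in> fst ` C" by induction (auto intro: step assms(3))
qed

section \<open>Transversals in the three cases\<close>

text \<open>
  Every vertex is followed by one in the next layer, so layer 0 cannot be avoided. All register orbits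
  have period \<open>k\<close>, so their points in layer 0 coincide.
\<close>

lemma extremal_if_word_length_dvd:
  assumes "finite \<Gamma>" "n > 0" "k > 0" "n dvd k"
  shows "extremal_factor (astute_graph \<Gamma> n k) (register_factor \<Gamma> n k rotate1)"
proof (rule extremal_register_factor_by_transversal[where S = "words \<Gamma> n \<times> {0}"])
  let ?A = "astute_map k rotate1"
  show "words \<Gamma> n \<times> {0} \<subseteq> astute_verts \<Gamma> n k" using assms by (auto simp: astute_verts_def)
  show "fst ` C \<inter> words \<Gamma> n \<times> {0} \<noteq> {}"
    if C: "C \<subseteq> arcs (astute_graph \<Gamma> n k)" "C \<noteq> {}" "perm_arcs C" for C
  proof -
    \<comment> \<open>Induction on the number \<open>d\<close> of steps up to the return to layer \<open>0 = k mod k\<close>.\<close>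
    have "\<exists>s. (s, 0) \<in> fst ` C" if "(s, k - d) \<in> fst ` C" "0 < d" "d \<le> k" for s d
      using that
    proof (induction d arbitrary: s)
      case (Suc d)
      then obtain t j where tj: "((s, k - Suc d), (t, j)) \<in> C" by force
      hence j: "j = (k - Suc d + 1) mod k" using C(1) astute_arc_iff by blast
      have "k - Suc d + 1 = k - d" using Suc by simp
      hence j': "j = (k - d) mod k" using j by metis
      have t: "(t, j) \<in> fst ` C" using tj C(3) by (force simp: perm_arcs_def)
      show ?case
      proof (cases "d = 0")
        case True thus ?thesis using t j' by auto
      next
        case False
        hence "j = k - d" using j' assms by simp
        thus ?thesis using Suc t False by auto
      qed
    qed simp
    moreover obtain s i where si: "(s, i) \<in> fst ` C"
      using C(2) by (metis all_not_in_conv image_is_empty surj_pair)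
    moreover have "i < k" using si C(1) astute_arc_iff by fastforce
    ultimately have "\<exists>s. (s, 0) \<in> fst ` C"
      by (metis diff_diff_cancel diff_le_self less_imp_le_nat zero_less_diff)
    moreover have "s \<in> words \<Gamma> n" if "(s, i) \<in> fst ` C" for s i
      using that C(1) astute_arc_iff by fastforce
    ultimately show ?thesis by blast
  qed
  show "x = y" if xy: "x \<in> words \<Gamma> n \<times> {0}" "y \<in> words \<Gamma> n \<times> {0}" "y \<in> orbit ?A x" for x y
  proof -
    have x: "x \<in> astute_verts \<Gamma> n k" using xy assms by (auto simp: astute_verts_def)
    obtain m where m: "m < k" "y = (?A ^^ m) x"
      using xy(3) orbit_altdef_bounded[OF astute_map_period[OF x assms(4) dvd_refl] assms(3)]
      by auto
    have "snd y = m" using xy(1) m assms(3) by (auto simp: astute_map_funpow)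
    thus ?thesis using xy(2) m by auto
  qed
qed (use assms in auto)

text \<open>
  For \<open>n = 2\<close> every moment is real, so there are no crossings. The weights 1 and -1 still sum to 0 and show
  that no cycle consists of strict ascents \<open>ab\<close> with \<open>v a < v b\<close> only. Of the orbit \<open>{ab, ba}\<close> only one
  word is not a strict ascent, unless both coincide.
\<close>

lemma extremal_de_Bruijn_2:
  assumes "finite \<Gamma>" "inj_on (v :: 'a \<Rightarrow> real) \<Gamma>"
  shows "extremal_factor (astute_graph \<Gamma> 2 1) (register_factor \<Gamma> 2 1 rotate1)"
proof (rule extremal_register_factor_by_transversal
    [where S = "{x \<in> astute_verts \<Gamma> 2 1. v (fst x ! 0) \<ge> v (fst x ! 1)}"])
  let ?A = "astute_map 1 rotate1" and ?V = "astute_verts \<Gamma> 2 1"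
  let ?S = "{x \<in> ?V. v (fst x ! 0) \<ge> v (fst x ! 1)}"
  show "fst ` C \<inter> ?S \<noteq> {}"
    if C: "C \<subseteq> arcs (astute_graph \<Gamma> 2 1)" "C \<noteq> {}" "perm_arcs C" for C
  proof
    assume emp: "fst ` C \<inter> ?S = {}"
    define c :: "nat \<Rightarrow> real" where "c j = (if j = 0 then 1 else - 1)" for j
    have "(\<Sum>j<2. c j) = 0" by (simp add: c_def numeral_2_eq_2)
    from weighted_letter_sum_zero[OF C(1,3) this, of v]
    have "(\<Sum>x\<in>fst ` C. v (fst x ! 0) - v (fst x ! 1)) = 0"
      by (simp add: c_def numeral_2_eq_2)
    moreover have "fst ` C \<subseteq> ?V" using C(1) by (auto simp: astute_graph_def)
    hence "v (fst x ! 0) - v (fst x ! 1) < 0" if "x \<in> fst ` C" for x using emp that by fastforce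
    hence "(\<Sum>x\<in>fst ` C. v (fst x ! 0) - v (fst x ! 1)) < (\<Sum>x\<in>fst ` C. 0)"
      using C by (intro sum_strict_mono) (auto simp: perm_arcs_def)
    ultimately show False by simp
  qed
  show "x = y" if x: "x \<in> ?S" and y: "y \<in> ?S" and o: "y \<in> orbit ?A x" for x y
  proof -
    have xV: "x \<in> ?V" using x by simp
    obtain s where s: "x = (s, 0)" "length s = 2" "set s \<subseteq> \<Gamma>"
      using xV by (auto simp: astute_verts_def words_def)
    then obtain a b where ab: "s = [a, b]" by (auto simp: length_Suc_conv numeral_2_eq_2)
    obtain m where m: "m < 2" "y = (?A ^^ m) x"
      using o orbit_altdef_bounded[OF astute_map_period[OF xV, of 2]] by auto
    show ?thesis
    proof (cases "m = 0")
      case False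
      hence "m = 1" using m by simp
      hence y': "y = ([b, a], 0)" using m by (simp add: s ab astute_map_def)
      hence "v a = v b" using x y by (simp add: s ab)
      hence "a = b" using s assms(2) by (auto simp: ab dest: inj_onD)
      thus ?thesis using y' s ab by simp
    qed (use m in simp)
  qed
qed (use assms in auto)

text \<open>
  Mykkeltveit's transversal. On an orbit with nonzero moments, \<open>k dvd n\<close> bounds the period by \<open>n\<close>, so
  distinct orbit points are turned against each other by less than a full turn and
  \<open>crossing_unique\<close> applies. The other orbits have no crossings and contribute one representative each.
\<close>

lemma extremal_if_dvd_word_length:
  fixes v :: "'a \<Rightarrow> real"
  assumes "finite \<Gamma>" "inj_on v \<Gamma>" "n \<ge> 3" "k dvd n"
  shows "extremal_factor (astute_graph \<Gamma> n k) (register_factor \<Gamma> n k rotate1)"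
proof -
  let ?A = "astute_map k rotate1" and ?V = "astute_verts \<Gamma> n k"
  have n: "n > 0" and k: "k > 0" using assms by (auto intro: Nat.gr0I)
  define rep where "rep x = (SOME y. y \<in> orbit ?A x)" for x :: "'a list \<times> nat"
  define S where "S = {x \<in> ?V. crossing n (moment v (fst x))}
    \<union> {x \<in> ?V. moment v (fst x) = 0 \<and> x = rep x}"
  have self: "x \<in> orbit ?A x" if "x \<in> ?V" for x using astute_orbit_self that n k by blast
  have rep: "rep x \<in> orbit ?A x" for x
    unfolding rep_def using orbit_nonempty by (metis some_in_eq)
  have rep_eq: "rep y = rep x" if "x \<in> ?V" "y \<in> orbit ?A x" for x y
    using orbit_eq_if_self[OF self[OF that(1)] that(2)] by (simp add: rep_def)
  have cross0: "\<not> crossing n 0" by (simp add: crossing_def)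
  show ?thesis
  proof (rule extremal_register_factor_by_transversal[OF assms(1) n k, where S = S])
    show "S \<subseteq> ?V" by (auto simp: S_def)
    show "fst ` C \<inter> S \<noteq> {}"
      if C: "C \<subseteq> arcs (astute_graph \<Gamma> n k)" "C \<noteq> {}" "perm_arcs C" for C
    proof
      assume emp: "fst ` C \<inter> S = {}"
      have V: "fst ` C \<subseteq> ?V" using C(1) by (auto simp: astute_graph_def)
      have no: "\<not> crossing n (moment v (fst x))" if "x \<in> fst ` C" for x
        using emp V that by (auto simp: S_def)
      obtain x where x: "x \<in> fst ` C" using C(2) by blast
      have "orbit ?A x \<subseteq> fst ` C"
        using perm_arcs_orbit_subset[OF C(3) _ x] crossing_or_rotating(2)[OF assms(3,2) C(1,3) no]
        by blast
      hence r: "rep x \<in> fst ` C" using rep by blast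
      have "rep (rep x) = rep x" using rep_eq rep x V by blast
      moreover have "moment v (fst (rep x)) = 0"
        using crossing_or_rotating(1)[OF assms(3,2) C(1,3) no] r by blast
      ultimately have "rep x \<in> S" using r V by (auto simp: S_def)
      thus False using r emp by blast
    qed
    show "x = y" if x: "x \<in> S" and y: "y \<in> S" and o: "y \<in> orbit ?A x" for x y
    proof -
      have xV: "x \<in> ?V" using x by (auto simp: S_def)
      show ?thesis
      proof (cases "moment v (fst x) = 0")
        case True
        hence "moment v (fst y) = 0" using moment_orbit_zero_iff[OF xV n o] by simp
        hence "x = rep x" "y = rep y" using True x y cross0 by (auto simp: S_def)
        thus ?thesis using rep_eq[OF xV o] by simp
      next
        case False
        hence "moment v (fst y) \<noteq> 0" using moment_orbit_zero_iff[OF xV n o] by simp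
        hence cr: "crossing n (moment v (fst x))" "crossing n (moment v (fst y))"
          using False x y by (auto simp: S_def)
        obtain m where m: "m < n" "y = (?A ^^ m) x"
          using o orbit_altdef_bounded[OF astute_map_period[OF xV dvd_refl assms(4)] n] by auto
        have "m = 0"
          using crossing_unique[OF assms(3) m(1) cr] moment_astute_map_funpow[OF xV n] m(2) by blast
        thus ?thesis using m by simp
      qed
    qed
  qed
qed

theorem theorem1:
  fixes \<Gamma> :: "'a set" and n k :: nat
  assumes "finite \<Gamma>" and "\<Gamma> \<noteq> {}"
    and "n > 0" and "k > 0"
    and "k dvd n \<or> n dvd k"
  shows "extremal_factor (astute_graph \<Gamma> n k) (register_factor \<Gamma> n k pure_cycling_register)"
proof (cases "n dvd k")
  case True
  thus ?thesis using extremal_if_word_length_dvd assms by blast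
next
  case False
  hence kn: "k dvd n" using assms by blast
  obtain f :: "'a \<Rightarrow> nat" where "inj_on f \<Gamma>"
    using finite_imp_inj_to_nat_seg[OF assms(1)] by metis
  hence v: "inj_on (\<lambda>a. real (f a)) \<Gamma>" by (auto simp: inj_on_def)
  show ?thesis
  proof (cases "n \<ge> 3")
    case True
    thus ?thesis using extremal_if_dvd_word_length[OF assms(1) v True kn] by simp
  next
    case F: False
    have "n \<noteq> 1" using False by auto
    hence n: "n = 2" using F assms(3) by linarith
    moreover have "k \<noteq> 2" using False n by auto
    moreover have "k \<le> 2" using kn n by (auto dest: dvd_imp_le)
    ultimately have "n = 2" "k = 1" using assms(4) by linarith+
    thus ?thesis using extremal_de_Bruijn_2[OF assms(1) v] by simp
  qed
qed

end
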